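(* Let $0<\alpha\le1$ and $T>0$. Let $A$ be a densely defined, self-adjoint, bounded above linear operator with compact resolvent on a separable Hilbert space $H$, and let $(\lambda_n)_{n\in\mathbb{N}}$ be the eigenvalues of $-A$, counted with multiplicity. Assume that $\lambda_n>0$ for all $n\in\mathbb{N}$ and that $\sum_{n=1}^\infty\frac{1}{\lambda_n^2}<\infty$. Let $K\ge1$ be a constant such that every solution $u$ of $\partial_t^\alpha u=Au$ on $(0,T)$ satisfies $\|u(t)\|\le K\|u(0)\|^{1-\frac tT}\|u(T)\|^{\frac tT}$ for $0\le t\le T$. For arbitrarily fixed constants $R>0$ and $\delta>0$, let $$M\subset\{u_0\in D(A):\ \|Au_0\|\le R,\ \|u_0\|\le R,\ \|u_0\|\ge\delta\}$$ be a set such that the embedding $M\subset H$ is compact. Then there exists a constant $\theta_0(\delta)\in(0,\tfrac12)$, depending on $R$ and $\delta$, such that $$\|u_0\|\le K R\sqrt{1+\frac{2T^\alpha}{\alpha\Gamma(\alpha)}}\;\|u(T)\|^{\theta_0(\delta)}$$ for all $u_0\in M$, where $u$ denotes the solution of $\partial_t^\alpha u=Au$ on $(0,T)$ with $u(0)=u_0$.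
   Context: $(H,\langle\cdot,\cdot\rangle)$ is a separable Hilbert space with norm $\|\cdot\|$. The operator $A:D(A)\subset H\to H$ is densely defined and linear and satisfies: (i) $A$ is self-adjoint; (ii) there is $\kappa\ge 0$ with $\langle Au,u\rangle\le\kappa\|u\|^2$ for all $u\in D(A)$; (iii) there is $\lambda>-\kappa$ such that the resolvent $(\lambda I-A)^{-1}$ exists and is compact. Consequently there is an orthonormal basis $\{\varphi_n\}_{n\in\mathbb{N}}$ of $H$ with $\varphi_n\in D(A)$, $-A\varphi_n=\lambda_n\varphi_n$, and $\lambda_1\le\lambda_2\le\cdots\to\infty$. "The embedding $M\subset H$ is compact" means that $M$ is relatively compact in $H$: every sequence in $M$ has a subsequence converging in $H$. The objects $H,A,\alpha,T$ are fixed throughout, so constants may also depend on them. The Caputo derivative is $\partial_t^\alpha g(t)=\frac{1}{\Gamma(1-\alpha)}\int_0^t(t-s)^{-\alpha}g'(s)\,ds$ for $0<\alpha<1$ and $\partial_t^1 g=g'$; $\Gamma$ is the Gamma function. The Mittag-Leffler function is $E_{\alpha,\beta}(z)=\sum_{k=0}^\infty\frac{z^k}{\Gamma(\alpha k+\beta)}$. Solutions: for $u_0\in H$ the solution of $\partial_t^\alpha u=Au$ on $(0,T)$ with $u(0)=u_0$ is $u(t)=\sum_{n=1}^\infty\langle u_0,\varphi_n\rangle E_{\alpha,1}(-\lambda_n t^\alpha)\varphi_n$, $t\in[0,T]$, which lies in $C([0,T];H)$. A constant $K\ge1$ as in the claim exists. *)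

theory Defs
  imports "HOL-Analysis.Analysis"
begin

(* An unbounded operator is a pair of a domain D and a total function A;
   the values of A outside D are never used. *)

definition linear_operator_on :: "'a::real_vector set \<Rightarrow> ('a \<Rightarrow> 'a) \<Rightarrow> bool" where
  "linear_operator_on D A \<longleftrightarrow> subspace D \<and>
     (\<forall>u\<in>D. \<forall>v\<in>D. A (u + v) = A u + A v) \<and> (\<forall>c. \<forall>u\<in>D. A (c *\<^sub>R u) = c *\<^sub>R A u)"

definition operator_graph :: "'a set \<Rightarrow> ('a \<Rightarrow> 'a) \<Rightarrow> ('a \<times> 'a) set" where
  "operator_graph D A = {(u, A u) | u. u \<in> D}"

(* For densely defined A this relation is single-valued: it is the graph of the adjoint. *)

definition adjoint_graph :: "'a::real_inner set \<Rightarrow> ('a \<Rightarrow> 'a) \<Rightarrow> ('a \<times> 'a) set" where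
  "adjoint_graph D A = {(v, w). \<forall>u\<in>D. A u \<bullet> v = u \<bullet> w}"

definition self_adjoint_operator :: "'a::real_inner set \<Rightarrow> ('a \<Rightarrow> 'a) \<Rightarrow> bool" where
  "self_adjoint_operator D A \<longleftrightarrow> linear_operator_on D A \<and> closure D = UNIV \<and>
     adjoint_graph D A = operator_graph D A"

definition relatively_compact :: "'a::topological_space set \<Rightarrow> bool" where
  "relatively_compact M \<longleftrightarrow>
     (\<forall>x :: nat \<Rightarrow> 'a. (\<forall>n. x n \<in> M) \<longrightarrow> (\<exists>l r. strict_mono r \<and> (x \<circ> r) \<longlonglongrightarrow> l))"

definition compact_operator :: "('a::real_normed_vector \<Rightarrow> 'a) \<Rightarrow> bool" where
  "compact_operator B \<longleftrightarrow> linear B \<and> (\<forall>S. bounded S \<longrightarrow> relatively_compact (B ` S))"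

(* Boundedness of the inverse is not listed separately: it follows from compactness. *)

definition has_compact_resolvent_at :: "'a::real_normed_vector set \<Rightarrow> ('a \<Rightarrow> 'a) \<Rightarrow> real \<Rightarrow> bool" where
  "has_compact_resolvent_at D A l \<longleftrightarrow>
     bij_betw (\<lambda>u. l *\<^sub>R u - A u) D UNIV \<and>
     compact_operator (inv_into D (\<lambda>u. l *\<^sub>R u - A u))"

definition bounded_above_compact_resolvent :: "'a::real_inner set \<Rightarrow> ('a \<Rightarrow> 'a) \<Rightarrow> bool" where
  "bounded_above_compact_resolvent D A \<longleftrightarrow>
     (\<exists>\<kappa>\<ge>0. (\<forall>u\<in>D. A u \<bullet> u \<le> \<kappa> * (norm u)\<^sup>2) \<and> (\<exists>l>-\<kappa>. has_compact_resolvent_at D A l))"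

definition orthonormal_basis :: "(nat \<Rightarrow> 'a::real_inner) \<Rightarrow> bool" where
  "orthonormal_basis \<phi> \<longleftrightarrow>
     (\<forall>m n. \<phi> m \<bullet> \<phi> n = (if m = n then 1 else 0)) \<and> closure (span (range \<phi>)) = UNIV"

(* lam enumerates the eigenvalues of -A with multiplicity, starting from index 0. *)

definition eigenbasis :: "'a::real_inner set \<Rightarrow> ('a \<Rightarrow> 'a) \<Rightarrow> (nat \<Rightarrow> 'a) \<Rightarrow> (nat \<Rightarrow> real) \<Rightarrow> bool" where
  "eigenbasis D A \<phi> lam \<longleftrightarrow> orthonormal_basis \<phi> \<and>
     (\<forall>n. \<phi> n \<in> D \<and> - A (\<phi> n) = lam n *\<^sub>R \<phi> n) \<and>
     mono lam \<and> filterlim lam at_top sequentially"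

definition mittag_leffler :: "real \<Rightarrow> real \<Rightarrow> real \<Rightarrow> real" where
  "mittag_leffler \<alpha> \<beta> z = (\<Sum>k. z ^ k / Gamma (\<alpha> * real k + \<beta>))"

(* u is, on [0,T], the solution of the Caputo evolution equation of order \<alpha> with u(0) = u0, given
   by its eigenfunction expansion; sums means convergence in the norm of the Hilbert space.
   For \<alpha> > 0 we have 0 powr \<alpha> = 0, as needed at t = 0. *)

definition evolution_solution ::
  "real \<Rightarrow> (nat \<Rightarrow> 'a::real_inner) \<Rightarrow> (nat \<Rightarrow> real) \<Rightarrow> real \<Rightarrow> 'a \<Rightarrow> (real \<Rightarrow> 'a) \<Rightarrow> bool" where
  "evolution_solution \<alpha> \<phi> lam T u0 u \<longleftrightarrow>
     (\<forall>t\<in>{0..T}.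
        (\<lambda>n. ((u0 \<bullet> \<phi> n) * mittag_leffler \<alpha> 1 (- lam n * t powr \<alpha>)) *\<^sub>R \<phi> n) sums u t)"

(* powr with the convention 0^0 = 1; in the library 0 powr 0 = 0. *)

definition rpow :: "real \<Rightarrow> real \<Rightarrow> real" where
  "rpow x a = (if a = 0 then 1 else x powr a)"

end

theory Submission
  imports Defs
begin

text \<open>
  Every admissible \<open>u0\<close> has norm at most \<open>R\<close>, and the constant
  \<open>c = sqrt (1 + 2 T^\<alpha> / (\<alpha> \<Gamma>(\<alpha>)))\<close> is strictly larger than \<open>1\<close>. So the estimate holds as soon as
  \<open>c * norm (u T) powr \<theta> \<ge> 1\<close>, and a lower bound \<open>m > 0\<close> for the norm of the final state,
  uniform in \<open>u0\<close>, allows this for all small \<open>\<theta>\<close> (lemma \<open>small_exponent_powr_ge\<close>).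

  The uniform lower bound is a matter of finitely many modes. The operator multiplies the \<open>n\<close>-th
  Fourier coefficient of \<open>u0\<close> by \<open>- lam n\<close>, and \<open>lam n\<close> tends to infinity; the bound on \<open>A u0\<close>
  therefore makes the tail of the expansion of \<open>u0\<close> uniformly small, and since
  \<open>norm u0 \<ge> \<delta>\<close>, a fixed number \<open>N\<close> of modes carries at least half of \<open>\<delta>\<^sup>2\<close>
  (\<open>low_modes_bounded_below\<close>). The evolution multiplies the \<open>n\<close>-th of them by
  \<open>E\<^sub>\<alpha>(- lam n * T^\<alpha>)\<close>, where \<open>E\<^sub>\<alpha>\<close> is the Mittag-Leffler function with second parameter \<open>1\<close>,
  and these \<open>N\<close> numbers are nonzero, hence bounded away from zero (\<open>final_state_bounded_below\<close>).

  That they are nonzero follows from the interpolation inequality itself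
  (\<open>mittag_leffler_nonzero_of_interpolation\<close>): applied to an eigenvector, it says that a mode that
  vanishes at time \<open>T\<close> vanishes throughout \<open>(0, T]\<close>, which contradicts
  \<open>E\<^sub>\<alpha>(- lam n * t^\<alpha>) \<longlonglongrightarrow> 1\<close> as \<open>t \<rightarrow> 0\<close>.
\<close>

section \<open>Finite expansions in an orthonormal basis\<close>

lemma norm_diff_orthonormal_sum_sq:
  fixes \<phi> :: "nat \<Rightarrow> 'a::real_inner"
  assumes "\<And>m n. \<phi> m \<bullet> \<phi> n = (if m = n then 1 else 0)"
  shows "(norm (x - (\<Sum>n<N. b n *\<^sub>R \<phi> n)))\<^sup>2
           = (norm x)\<^sup>2 - (\<Sum>n<N. (x \<bullet> \<phi> n)\<^sup>2) + (\<Sum>n<N. (x \<bullet> \<phi> n - b n)\<^sup>2)"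
proof -
  let ?s = "\<Sum>n<N. b n *\<^sub>R \<phi> n"
  have "?s \<bullet> ?s = (\<Sum>n<N. (b n)\<^sup>2)"
    by (simp add: inner_sum_left inner_sum_right assms power2_eq_square if_distrib
        cong: if_cong)
  moreover have "x \<bullet> ?s = (\<Sum>n<N. b n * (x \<bullet> \<phi> n))"
    by (simp add: inner_sum_right)
  moreover have "(norm (x - ?s))\<^sup>2 = (norm x)\<^sup>2 - 2 * (x \<bullet> ?s) + ?s \<bullet> ?s"
    by (simp add: power2_norm_eq_inner inner_diff_left inner_diff_right inner_commute)
  ultimately show ?thesis
    by (simp add: power2_diff sum.distrib sum_subtractf sum_distrib_left algebra_simps)
qed

lemma Bessel_finite:
  fixes \<phi> :: "nat \<Rightarrow> 'a::real_inner"
  assumes "\<And>m n. \<phi> m \<bullet> \<phi> n = (if m = n then 1 else 0)"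
  shows "(\<Sum>n<N. (x \<bullet> \<phi> n)\<^sup>2) \<le> (norm x)\<^sup>2"
  using norm_diff_orthonormal_sum_sq[OF assms, of x "\<lambda>n. x \<bullet> \<phi> n" N]
    zero_le_power2[of "norm (x - (\<Sum>n<N. (x \<bullet> \<phi> n) *\<^sub>R \<phi> n))"]
  by simp

text \<open>Asking for the expansion at all large lengths, rather than at one, makes the property closed
  under addition.\<close>

lemma span_eventually_eq_orthonormal_expansion:
  fixes \<phi> :: "nat \<Rightarrow> 'a::real_inner"
  assumes on: "\<And>m n. \<phi> m \<bullet> \<phi> n = (if m = n then 1 else 0)"
    and "y \<in> span (range \<phi>)"
  shows "eventually (\<lambda>N. y = (\<Sum>n<N. (y \<bullet> \<phi> n) *\<^sub>R \<phi> n)) sequentially"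
proof -
  let ?S = "{y. eventually (\<lambda>N. y = (\<Sum>n<N. (y \<bullet> \<phi> n) *\<^sub>R \<phi> n)) sequentially}"
  have "range \<phi> \<subseteq> ?S"
  proof clarify
    fix k
    have "\<phi> k = (\<Sum>n<N. (\<phi> k \<bullet> \<phi> n) *\<^sub>R \<phi> n)" if "N > k" for N
      using that by (simp add: on if_distrib[of "\<lambda>c. c *\<^sub>R _"] cong: if_cong)
    then show "eventually (\<lambda>N. \<phi> k = (\<Sum>n<N. (\<phi> k \<bullet> \<phi> n) *\<^sub>R \<phi> n)) sequentially"
      by (rule eventually_mono[OF eventually_gt_at_top[of k]])
  qed
  moreover have "subspace ?S"
  proof (rule subspaceI)
    show "0 \<in> ?S" by simp
    show "x + y \<in> ?S" if "x \<in> ?S" "y \<in> ?S" for x y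
    proof -
      have "eventually (\<lambda>N. x = (\<Sum>n<N. (x \<bullet> \<phi> n) *\<^sub>R \<phi> n)
                          \<and> y = (\<Sum>n<N. (y \<bullet> \<phi> n) *\<^sub>R \<phi> n)) sequentially"
        using that by (simp add: eventually_conj)
      then have "eventually (\<lambda>N. x + y = (\<Sum>n<N. ((x + y) \<bullet> \<phi> n) *\<^sub>R \<phi> n)) sequentially"
        by (rule eventually_mono) (simp add: inner_add_left scaleR_left_distrib sum.distrib)
      then show ?thesis by simp
    qed
    show "c *\<^sub>R x \<in> ?S" if "x \<in> ?S" for c x
    proof -
      have "eventually (\<lambda>N. x = (\<Sum>n<N. (x \<bullet> \<phi> n) *\<^sub>R \<phi> n)) sequentially"
        using that by simp
      then have "eventually (\<lambda>N. c *\<^sub>R x = (\<Sum>n<N. ((c *\<^sub>R x) \<bullet> \<phi> n) *\<^sub>R \<phi> n)) sequentially"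
        by (rule eventually_mono) (metis (no_types, lifting) inner_scaleR_left
            scaleR_right.sum scaleR_scaleR sum.cong)
      then show ?thesis by simp
    qed
  qed
  ultimately have "span (range \<phi>) \<subseteq> ?S"
    by (rule span_minimal)
  then show ?thesis using assms(2) by blast
qed

text \<open>The completeness half of Parseval's identity: an element of the span close to \<open>x\<close> is a
  finite expansion, and the partial Fourier sum of \<open>x\<close> of the same length is at least as close.\<close>

lemma Parseval_approx:
  fixes \<phi> :: "nat \<Rightarrow> 'a::real_inner"
  assumes ob: "orthonormal_basis \<phi>" and "0 < \<epsilon>"
  shows "eventually (\<lambda>N. (norm x)\<^sup>2 < (\<Sum>n<N. (x \<bullet> \<phi> n)\<^sup>2) + \<epsilon>) sequentially"
proof -
  have on: "\<And>m n. \<phi> m \<bullet> \<phi> n = (if m = n then 1 else 0)"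
    and "x \<in> closure (span (range \<phi>))"
    using ob by (auto simp: orthonormal_basis_def)
  then obtain y where y: "y \<in> span (range \<phi>)" "dist y x < sqrt \<epsilon>"
    using \<open>0 < \<epsilon>\<close> by (meson closure_approachable real_sqrt_gt_zero)
  have "(norm (x - y))\<^sup>2 < \<epsilon>"
    using y(2) \<open>0 < \<epsilon>\<close>
    by (metis dist_commute dist_norm norm_ge_zero order_less_le power2_less_imp_less
        power_strict_mono real_sqrt_pow2 zero_less_numeral)
  moreover have "(norm x)\<^sup>2 - (\<Sum>n<N. (x \<bullet> \<phi> n)\<^sup>2) \<le> (norm (x - y))\<^sup>2"
    if "y = (\<Sum>n<N. (y \<bullet> \<phi> n) *\<^sub>R \<phi> n)" for N
  proof -
    have "(norm (x - y))\<^sup>2 = (norm x)\<^sup>2 - (\<Sum>n<N. (x \<bullet> \<phi> n)\<^sup>2) + (\<Sum>n<N. (x \<bullet> \<phi> n - y \<bullet> \<phi> n)\<^sup>2)"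
      using norm_diff_orthonormal_sum_sq[OF on, of x "\<lambda>n. y \<bullet> \<phi> n" N] that by simp
    moreover have "0 \<le> (\<Sum>n<N. (x \<bullet> \<phi> n - y \<bullet> \<phi> n)\<^sup>2)" by (simp add: sum_nonneg)
    ultimately show ?thesis by linarith
  qed
  ultimately show ?thesis
    using span_eventually_eq_orthonormal_expansion[OF on y(1)]
    by (elim eventually_mono) (smt (verit))
qed

section \<open>Nonvanishing of the Mittag-Leffler factors\<close>

text \<open>The minimum over \<open>[1, 2]\<close> is a lower bound on all of \<open>[1, \<infinity>)\<close>, because the factor \<open>x - 1\<close>
  in \<open>\<Gamma>(x) = (x - 1) \<Gamma>(x - 1)\<close> is at least \<open>1\<close> for \<open>x \<ge> 2\<close>.\<close>

lemma Gamma_real_bounded_below: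
  obtains g :: real where "0 < g" "\<And>x. 1 \<le> x \<Longrightarrow> g \<le> Gamma x"
proof -
  have "continuous_on {1..2} (Gamma :: real \<Rightarrow> real)"
    by (intro continuous_on_Gamma) (auto elim!: nonpos_Ints_cases)
  then obtain p :: real where p: "p \<in> {1..2}" "\<And>y. y \<in> {1..2} \<Longrightarrow> Gamma p \<le> Gamma y"
    using continuous_attains_inf[of "{1..2::real}" Gamma] by auto
  have shifted: "1 \<le> x \<Longrightarrow> x \<le> 2 + real k \<Longrightarrow> Gamma p \<le> Gamma x" for x k
  proof (induction k arbitrary: x)
    case 0
    then show ?case using p(2) by simp
  next
    case (Suc k)
    show ?case
    proof (cases "x \<le> 2")
      case True
      then show ?thesis using p(2) Suc.prems by simp
    next
      case False
      have "Gamma x = (x - 1) * Gamma (x - 1)"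
        using Gamma_plus1[of "x - 1"] nonpos_Ints_nonpos[of "x - 1"] False by fastforce
      moreover have "Gamma (x - 1) > 0" using False by (intro Gamma_real_pos) simp
      moreover have "Gamma p \<le> Gamma (x - 1)" using Suc False by simp
      moreover have "1 * Gamma (x - 1) \<le> (x - 1) * Gamma (x - 1)"
        using False calculation(2) by (intro mult_right_mono) auto
      ultimately show ?thesis by linarith
    qed
  qed
  show thesis
  proof (rule that[of "Gamma p"])
    show "0 < Gamma p" using p(1) by (intro Gamma_real_pos) auto
    show "Gamma p \<le> Gamma x" if "1 \<le> x" for x
    proof -
      obtain k :: nat where "x \<le> real k" using real_arch_simple by blast
      then show ?thesis using shifted[of x k] that by simp
    qed
  qed
qed

text \<open>Only the behaviour at the origin matters here, so convergence of the power series on the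
  unit disc is enough, and for this it suffices that its coefficients are bounded.\<close>

lemma mittag_leffler_tendsto_1:
  assumes "0 < \<alpha>"
  shows "(mittag_leffler \<alpha> 1 \<longlongrightarrow> 1) (at 0)"
proof -
  define a where "a = (\<lambda>k. 1 / Gamma (\<alpha> * real k + 1))"
  obtain g :: real where g: "0 < g" "\<And>x. 1 \<le> x \<Longrightarrow> g \<le> Gamma x"
    using Gamma_real_bounded_below by blast
  have a: "\<bar>a k\<bar> \<le> 1 / g" for k
  proof -
    have "g \<le> Gamma (\<alpha> * real k + 1)" using assms by (intro g(2)) simp
    then show ?thesis using g(1) by (simp add: a_def frac_le)
  qed
  have "(\<lambda>k. a k * x ^ k) sums mittag_leffler \<alpha> 1 x" if "norm x < 1" for x
  proof -
    have "summable (\<lambda>k. a k * x ^ k)"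
    proof (rule summable_comparison_test')
      show "summable (\<lambda>k. 1 / g * \<bar>x\<bar> ^ k)" using that by (simp add: summable_mult)
      show "norm (a k * x ^ k) \<le> 1 / g * \<bar>x\<bar> ^ k" if "0 \<le> k" for k
        unfolding real_norm_def abs_mult power_abs by (intro mult_right_mono a) simp
    qed
    then show ?thesis
      by (simp add: mittag_leffler_def a_def summable_sums)
  qed
  then have "(mittag_leffler \<alpha> 1 \<longlongrightarrow> a 0) (at 0)"
    by (intro powser_limit_0[of 1]) auto
  then show ?thesis by (simp add: a_def)
qed

lemma evolution_solution_eigenvector:
  assumes "\<And>m n. \<phi> m \<bullet> \<phi> n = (if m = n then 1 else 0)"
  shows "evolution_solution \<alpha> \<phi> lam T (\<phi> n)
           (\<lambda>t. mittag_leffler \<alpha> 1 (- lam n * t powr \<alpha>) *\<^sub>R \<phi> n)"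
  unfolding evolution_solution_def
proof
  fix t
  let ?e = "\<lambda>k. mittag_leffler \<alpha> 1 (- lam k * t powr \<alpha>)"
  have "(\<lambda>k. ((\<phi> n \<bullet> \<phi> k) * ?e k) *\<^sub>R \<phi> k) = (\<lambda>k. if k = n then ?e k *\<^sub>R \<phi> k else 0)"
    by (auto simp: assms)
  then show "(\<lambda>k. ((\<phi> n \<bullet> \<phi> k) * ?e k) *\<^sub>R \<phi> k) sums (?e n *\<^sub>R \<phi> n)"
    using sums_single[of n "\<lambda>k. ?e k *\<^sub>R \<phi> k"] by simp
qed

text \<open>If the factor of a mode vanished at time \<open>T\<close>, the interpolation inequality for the
  corresponding eigenvector would make it vanish at every \<open>t \<in> (0, T]\<close>, whereas it tends to
  \<open>1\<close> as \<open>t \<rightarrow> 0\<close>.\<close>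

lemma mittag_leffler_nonzero_of_interpolation:
  assumes "0 < \<alpha>" "0 < T" and pos: "0 < lam n"
    and on: "\<And>m n. \<phi> m \<bullet> \<phi> n = (if m = n then 1 else 0)"
    and interp: "\<And>v u t. evolution_solution \<alpha> \<phi> lam T v u \<Longrightarrow> t \<in> {0..T} \<Longrightarrow>
        norm (u t) \<le> K * rpow (norm (u 0)) (1 - t / T) * rpow (norm (u T)) (t / T)"
  shows "mittag_leffler \<alpha> 1 (- lam n * T powr \<alpha>) \<noteq> 0"
proof
  let ?e = "\<lambda>t. mittag_leffler \<alpha> 1 (- lam n * t powr \<alpha>)"
  assume zero: "?e T = 0"
  have norm1: "norm (\<phi> n) = 1" by (simp add: norm_eq_sqrt_inner on)
  have vanish: "?e t = 0" if "0 < t" "t \<le> T" for t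
    using interp[OF evolution_solution_eigenvector[OF on, where n = n], of t] that zero \<open>0 < T\<close>
    by (simp add: norm1 rpow_def)
  have "((\<lambda>t. t powr \<alpha>) \<longlongrightarrow> 0) (at_right 0)"
    using \<open>0 < \<alpha>\<close> eventually_at_right_less[of "0::real"]
    by (auto intro!: tendsto_eq_intros elim!: eventually_mono)
  then have "((\<lambda>t. - lam n * t powr \<alpha>) \<longlongrightarrow> 0) (at_right 0)"
    using tendsto_mult_left[of _ 0 _ "- lam n"] by simp
  moreover have "eventually (\<lambda>t. - lam n * t powr \<alpha> \<noteq> 0) (at_right 0)"
    using eventually_at_right_less[of 0] pos by (auto elim!: eventually_mono)
  ultimately have "filterlim (\<lambda>t. - lam n * t powr \<alpha>) (at 0) (at_right 0)"
    by (simp add: filterlim_at)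
  then have "(?e \<longlongrightarrow> 1) (at_right 0)"
    by (rule filterlim_compose[OF mittag_leffler_tendsto_1[OF \<open>0 < \<alpha>\<close>]])
  moreover have "eventually (\<lambda>t. ?e t = 0) (at_right 0)"
    using eventually_at_right[OF \<open>0 < T\<close>] vanish \<open>0 < T\<close> by (auto intro!: exI[of _ T])
  then have "(?e \<longlongrightarrow> 0) (at_right 0)"
    by (rule tendsto_eventually)
  ultimately show False
    using tendsto_unique trivial_limit_at_right_real by (metis zero_neq_one)
qed

section \<open>Lower bound for the final state\<close>

text \<open>The high modes of \<open>u0\<close> carry little of its norm, by the bound on \<open>A u0\<close> and the growth of
  the eigenvalues, so a number of modes that is uniform in \<open>u0\<close> carries a fixed part of it.\<close>

lemma low_modes_bounded_below:
  assumes sa: "self_adjoint_operator D A" and eb: "eigenbasis D A \<phi> lam"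
    and "0 < \<delta>"
  obtains N where "\<And>u0. u0 \<in> D \<Longrightarrow> norm (A u0) \<le> R \<Longrightarrow> \<delta> \<le> norm u0 \<Longrightarrow>
      \<delta>\<^sup>2 / 2 \<le> (\<Sum>n<N. (u0 \<bullet> \<phi> n)\<^sup>2)"
proof -
  have ob: "orthonormal_basis \<phi>"
    and on: "\<And>m n. \<phi> m \<bullet> \<phi> n = (if m = n then 1 else 0)"
    and "mono lam" and lim: "filterlim lam at_top sequentially"
    and ev: "\<And>n. \<phi> n \<in> D" "\<And>n. - A (\<phi> n) = lam n *\<^sub>R \<phi> n"
    using eb by (auto simp: eigenbasis_def orthonormal_basis_def)
  \<comment> \<open>With this threshold the modes from \<open>N\<close> on carry at most a quarter of \<open>\<delta>\<^sup>2\<close>.\<close>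
  define L where "L = 2 * \<bar>R\<bar> / \<delta> + 1"
  have "L > 0" using \<open>0 < \<delta>\<close> by (simp add: L_def add_nonneg_pos)
  obtain N where "L \<le> lam N"
    using lim unfolding filterlim_at_top eventually_sequentially by blast
  then have L: "L \<le> lam n" if "N \<le> n" for n
    using \<open>mono lam\<close> that by (meson monoD order_trans)
  show thesis
  proof (rule that[of N])
    fix u0 assume u0: "u0 \<in> D" "norm (A u0) \<le> R" "\<delta> \<le> norm u0"
    have "(u0, A u0) \<in> adjoint_graph D A"
      using sa u0(1) by (auto simp: self_adjoint_operator_def operator_graph_def)
    then have sym: "A (\<phi> n) \<bullet> u0 = \<phi> n \<bullet> A u0" for n
      using ev(1) by (auto simp: adjoint_graph_def)
    have "A (\<phi> n) = - (lam n *\<^sub>R \<phi> n)" for n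
      using ev(2)[of n] by (metis minus_minus)
    then have coeff: "A u0 \<bullet> \<phi> n = - lam n * (u0 \<bullet> \<phi> n)" for n
      using sym[of n] by (simp add: inner_commute)
    have "eventually (\<lambda>m. N \<le> m \<and> (norm u0)\<^sup>2 < (\<Sum>n<m. (u0 \<bullet> \<phi> n)\<^sup>2) + \<delta>\<^sup>2 / 4) sequentially"
      using Parseval_approx[OF ob, of "\<delta>\<^sup>2 / 4" u0] \<open>0 < \<delta>\<close>
      by (intro eventually_conj eventually_ge_at_top) simp
    then obtain m where m: "N \<le> m" "(norm u0)\<^sup>2 < (\<Sum>n<m. (u0 \<bullet> \<phi> n)\<^sup>2) + \<delta>\<^sup>2 / 4"
      by (auto dest: eventually_happens)
    have "L\<^sup>2 * (\<Sum>n=N..<m. (u0 \<bullet> \<phi> n)\<^sup>2) = (\<Sum>n=N..<m. L\<^sup>2 * (u0 \<bullet> \<phi> n)\<^sup>2)"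
      by (rule sum_distrib_left)
    also have "\<dots> \<le> (\<Sum>n=N..<m. (A u0 \<bullet> \<phi> n)\<^sup>2)"
    proof (rule sum_mono)
      fix n assume "n \<in> {N..<m}"
      then have "L\<^sup>2 \<le> (lam n)\<^sup>2" using L \<open>L > 0\<close> by (intro power_mono) auto
      then show "L\<^sup>2 * (u0 \<bullet> \<phi> n)\<^sup>2 \<le> (A u0 \<bullet> \<phi> n)\<^sup>2"
        by (simp add: coeff power_mult_distrib mult_right_mono)
    qed
    also have "\<dots> \<le> (\<Sum>n<m. (A u0 \<bullet> \<phi> n)\<^sup>2)"
      by (rule sum_mono2) auto
    also have "\<dots> \<le> (norm (A u0))\<^sup>2" by (rule Bessel_finite[OF on])
    also have "\<dots> \<le> R\<^sup>2" using u0(2) by (intro power_mono) auto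
    also have "\<dots> \<le> L\<^sup>2 * (\<delta>\<^sup>2 / 4)"
    proof -
      have "\<bar>R\<bar> \<le> L * (\<delta> / 2)" using \<open>0 < \<delta>\<close> by (simp add: L_def field_simps)
      then have "\<bar>R\<bar>\<^sup>2 \<le> (L * (\<delta> / 2))\<^sup>2" by (intro power_mono) auto
      then show ?thesis by (simp add: power_mult_distrib power_divide)
    qed
    finally have tail: "(\<Sum>n=N..<m. (u0 \<bullet> \<phi> n)\<^sup>2) \<le> \<delta>\<^sup>2 / 4"
      using \<open>L > 0\<close> by (simp add: mult_le_cancel_left_pos)
    have "(\<Sum>n<m. (u0 \<bullet> \<phi> n)\<^sup>2) = (\<Sum>n<N. (u0 \<bullet> \<phi> n)\<^sup>2) + (\<Sum>n=N..<m. (u0 \<bullet> \<phi> n)\<^sup>2)"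
      using m(1) by (simp add: lessThan_atLeast0 sum.atLeastLessThan_concat)
    moreover have "\<delta>\<^sup>2 \<le> (norm u0)\<^sup>2" using u0(3) \<open>0 < \<delta>\<close> by (intro power_mono) auto
    ultimately show "\<delta>\<^sup>2 / 2 \<le> (\<Sum>n<N. (u0 \<bullet> \<phi> n)\<^sup>2)"
      using m(2) tail by linarith
  qed
qed

lemma evolution_solution_coefficient:
  assumes on: "\<And>m n. \<phi> m \<bullet> \<phi> n = (if m = n then 1 else 0)"
    and "evolution_solution \<alpha> \<phi> lam T u0 u" and "t \<in> {0..T}"
  shows "u t \<bullet> \<phi> n = (u0 \<bullet> \<phi> n) * mittag_leffler \<alpha> 1 (- lam n * t powr \<alpha>)"
proof -
  let ?c = "\<lambda>k. (u0 \<bullet> \<phi> k) * mittag_leffler \<alpha> 1 (- lam k * t powr \<alpha>)"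
  have "(\<lambda>k. ?c k *\<^sub>R \<phi> k) sums u t"
    using assms(2,3) by (simp add: evolution_solution_def)
  then have "(\<lambda>k. (?c k *\<^sub>R \<phi> k) \<bullet> \<phi> n) sums (u t \<bullet> \<phi> n)"
    by (rule bounded_linear.sums[OF bounded_linear_inner_left])
  moreover have "(\<lambda>k. (?c k *\<^sub>R \<phi> k) \<bullet> \<phi> n) = (\<lambda>k. if k = n then ?c k else 0)"
    by (auto simp: on)
  ultimately show ?thesis
    using sums_single[of n ?c] by (auto dest: sums_unique2)
qed

lemma final_state_bounded_below:
  assumes sa: "self_adjoint_operator D A" and eb: "eigenbasis D A \<phi> lam"
    and "0 < \<delta>" "0 \<le> T"
    and nz: "\<And>n. mittag_leffler \<alpha> 1 (- lam n * T powr \<alpha>) \<noteq> 0"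
  obtains m where "0 < m"
    "\<And>u0 u. u0 \<in> D \<Longrightarrow> norm (A u0) \<le> R \<Longrightarrow> \<delta> \<le> norm u0 \<Longrightarrow>
       evolution_solution \<alpha> \<phi> lam T u0 u \<Longrightarrow> m \<le> norm (u T)"
proof -
  have on: "\<And>m n. \<phi> m \<bullet> \<phi> n = (if m = n then 1 else 0)"
    using eb by (auto simp: eigenbasis_def orthonormal_basis_def)
  let ?e = "\<lambda>n. mittag_leffler \<alpha> 1 (- lam n * T powr \<alpha>)"
  obtain N where N: "\<And>u0. u0 \<in> D \<Longrightarrow> norm (A u0) \<le> R \<Longrightarrow> \<delta> \<le> norm u0 \<Longrightarrow>
      \<delta>\<^sup>2 / 2 \<le> (\<Sum>n<N. (u0 \<bullet> \<phi> n)\<^sup>2)"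
    using low_modes_bounded_below[OF sa eb \<open>0 < \<delta>\<close>] by blast
  \<comment> \<open>The inserted \<open>1\<close> keeps the minimum meaningful when \<open>N = 0\<close>.\<close>
  define q where "q = Min (insert 1 ((\<lambda>n. (?e n)\<^sup>2) ` {..<N}))"
  have "0 < q" using nz by (auto simp: q_def)
  have q: "q \<le> (?e n)\<^sup>2" if "n < N" for n
    using that by (auto simp: q_def intro!: Min_le)
  show thesis
  proof (rule that[of "sqrt (q * (\<delta>\<^sup>2 / 2))"])
    show "0 < sqrt (q * (\<delta>\<^sup>2 / 2))" using \<open>0 < q\<close> \<open>0 < \<delta>\<close> by simp
    fix u0 u
    assume u0: "u0 \<in> D" "norm (A u0) \<le> R" "\<delta> \<le> norm u0"
      and sol: "evolution_solution \<alpha> \<phi> lam T u0 u"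
    have "q * (\<delta>\<^sup>2 / 2) \<le> q * (\<Sum>n<N. (u0 \<bullet> \<phi> n)\<^sup>2)"
      using N[OF u0] \<open>0 < q\<close> by (intro mult_left_mono) auto
    also have "\<dots> = (\<Sum>n<N. q * (u0 \<bullet> \<phi> n)\<^sup>2)" by (rule sum_distrib_left)
    also have "\<dots> \<le> (\<Sum>n<N. (u T \<bullet> \<phi> n)\<^sup>2)"
    proof (rule sum_mono)
      fix n assume "n \<in> {..<N}"
      then have "q * (u0 \<bullet> \<phi> n)\<^sup>2 \<le> (?e n)\<^sup>2 * (u0 \<bullet> \<phi> n)\<^sup>2"
        using q by (intro mult_right_mono) auto
      then show "q * (u0 \<bullet> \<phi> n)\<^sup>2 \<le> (u T \<bullet> \<phi> n)\<^sup>2"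
        using evolution_solution_coefficient[OF on sol, of T n] \<open>0 \<le> T\<close>
        by (simp add: power_mult_distrib mult.commute)
    qed
    also have "\<dots> \<le> (norm (u T))\<^sup>2" by (rule Bessel_finite[OF on])
    finally show "sqrt (q * (\<delta>\<^sup>2 / 2)) \<le> norm (u T)"
      by (intro real_le_lsqrt) auto
  qed
qed

lemma small_exponent_powr_ge:
  fixes c m :: real
  assumes "1 < c" "0 < m"
  obtains \<theta> where "0 < \<theta>" "\<theta> < 1/2" "\<And>x. m \<le> x \<Longrightarrow> 1 \<le> c * x powr \<theta>"
proof -
  define \<theta> where "\<theta> = min (1/4) (ln c / (1 + \<bar>ln m\<bar>))"
  have "0 < ln c" using assms by simp
  have \<theta>: "0 < \<theta>" "\<theta> < 1/2" using \<open>0 < ln c\<close> by (auto simp: \<theta>_def min_def)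
  have "\<theta> * \<bar>ln m\<bar> \<le> \<theta> * (1 + \<bar>ln m\<bar>)" using \<theta> by simp
  also have "\<dots> \<le> ln c / (1 + \<bar>ln m\<bar>) * (1 + \<bar>ln m\<bar>)"
    by (intro mult_right_mono) (auto simp: \<theta>_def)
  also have "\<dots> = ln c" by simp
  finally have "\<theta> * \<bar>ln m\<bar> \<le> ln c" .
  moreover have "\<theta> * - ln m \<le> \<theta> * \<bar>ln m\<bar>" using \<theta> by (intro mult_left_mono) auto
  ultimately have "0 \<le> ln c + \<theta> * ln m" by simp
  then have "1 \<le> exp (ln c + \<theta> * ln m)" by simp
  also have "\<dots> = c * m powr \<theta>" using assms by (simp add: exp_add powr_def)
  finally have m: "1 \<le> c * m powr \<theta>" .
  show thesis
  proof (rule that[OF \<theta>])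
    fix x assume "m \<le> x"
    then have "m powr \<theta> \<le> x powr \<theta>" using assms \<theta> by (intro powr_mono2) auto
    then have "c * m powr \<theta> \<le> c * x powr \<theta>" using assms by simp
    with m show "1 \<le> c * x powr \<theta>" by linarith
  qed
qed

section \<open>The stability estimate\<close>

theorem proposition1:
  fixes D :: "'a::{real_inner, polish_space} set"
    and A :: "'a \<Rightarrow> 'a"
    and \<phi> :: "nat \<Rightarrow> 'a"
    and lam :: "nat \<Rightarrow> real"
    and \<alpha> T R \<delta> :: real
  assumes "0 < \<alpha>" and "\<alpha> \<le> 1" and "0 < T"
    and "self_adjoint_operator D A"
    and "bounded_above_compact_resolvent D A"
    and "eigenbasis D A \<phi> lam"
    and "\<And>n. 0 < lam n"
    and "summable (\<lambda>n. 1 / (lam n)\<^sup>2)"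
    and "0 < R" and "0 < \<delta>"
  shows "\<exists>\<theta>\<^sub>0. 0 < \<theta>\<^sub>0 \<and> \<theta>\<^sub>0 < 1/2 \<and>
    (\<forall>K M. 1 \<le> K \<longrightarrow>
      (\<forall>v u. evolution_solution \<alpha> \<phi> lam T v u \<longrightarrow>
        (\<forall>t\<in>{0..T}. norm (u t)
          \<le> K * rpow (norm (u 0)) (1 - t / T) * rpow (norm (u T)) (t / T))) \<longrightarrow>
      M \<subseteq> {u0 \<in> D. norm (A u0) \<le> R \<and> norm u0 \<le> R \<and> \<delta> \<le> norm u0} \<longrightarrow>
      relatively_compact M \<longrightarrow>
      (\<forall>u0\<in>M. \<forall>u. evolution_solution \<alpha> \<phi> lam T u0 u \<longrightarrow>
        norm u0 \<le> K * R * sqrt (1 + 2 * T powr \<alpha> / (\<alpha> * Gamma \<alpha>))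
                   * norm (u T) powr \<theta>\<^sub>0))"
proof -
  define c where "c = sqrt (1 + 2 * T powr \<alpha> / (\<alpha> * Gamma \<alpha>))"
  have "0 < Gamma \<alpha>" using \<open>0 < \<alpha>\<close> by (rule Gamma_real_pos)
  then have "1 < c" using assms(1,3) by (simp add: c_def)
  have on: "\<And>m n. \<phi> m \<bullet> \<phi> n = (if m = n then 1 else 0)"
    using assms(6) by (auto simp: eigenbasis_def orthonormal_basis_def)
  let ?interp = "\<lambda>K. \<forall>v u. evolution_solution \<alpha> \<phi> lam T v u \<longrightarrow>
        (\<forall>t\<in>{0..T}. norm (u t)
          \<le> K * rpow (norm (u 0)) (1 - t / T) * rpow (norm (u T)) (t / T))"
  \<comment> \<open>The exponent precedes \<open>K\<close>, and nonvanishing of the factors does not depend on which \<open>K\<close>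
      is admissible; if none is, any exponent will do.\<close>
  show ?thesis
  proof (cases "\<exists>K. ?interp K")
    case False
    then show ?thesis by (intro exI[of _ "1/4"]) auto
  next
    case True
    then obtain K' where "?interp K'" by blast
    then have nz: "mittag_leffler \<alpha> 1 (- lam n * T powr \<alpha>) \<noteq> 0" for n
      using assms(1,3,7)
      by (intro mittag_leffler_nonzero_of_interpolation[where \<phi> = \<phi> and K = K', OF _ _ _ on]) auto
    obtain m where m: "0 < m"
      "\<And>u0 u. u0 \<in> D \<Longrightarrow> norm (A u0) \<le> R \<Longrightarrow> \<delta> \<le> norm u0 \<Longrightarrow>
         evolution_solution \<alpha> \<phi> lam T u0 u \<Longrightarrow> m \<le> norm (u T)"
      using final_state_bounded_below[OF assms(4,6,10) less_imp_le[OF assms(3)] nz] by blast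
    obtain \<theta> where \<theta>: "0 < \<theta>" "\<theta> < 1/2" "\<And>x. m \<le> x \<Longrightarrow> 1 \<le> c * x powr \<theta>"
      using small_exponent_powr_ge[OF \<open>1 < c\<close> m(1)] by blast
    have "norm u0 \<le> K * R * c * norm (u T) powr \<theta>"
      if "1 \<le> K" "u0 \<in> D" "norm (A u0) \<le> R" "norm u0 \<le> R" "\<delta> \<le> norm u0"
        and "evolution_solution \<alpha> \<phi> lam T u0 u" for K u0 u
    proof -
      have "1 \<le> c * norm (u T) powr \<theta>" using m(2) \<theta>(3) that by blast
      moreover have "R \<le> K * R" using \<open>1 \<le> K\<close> \<open>0 < R\<close> by simp
      ultimately have "R * 1 \<le> (K * R) * (c * norm (u T) powr \<theta>)"
        using \<open>0 < R\<close> \<open>1 \<le> K\<close> by (intro mult_mono) auto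
      then show ?thesis using that(4) by (simp add: mult.assoc)
    qed
    then show ?thesis
      unfolding c_def using \<theta>(1,2) by (intro exI[of _ \<theta>]) blast
  qed
qed

end
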